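(* For every integer $L\geq 2$, the following coefficientwise inequality of formal power series in $q$ holds: $$ \frac{1}{(q;q^2)_{L-1}}\left(\frac{1-q^{2L-2}}{1-q^2}+q^3\genfrac{[}{]}{0pt}{}{L-1}{2}_{q^2}\right)\ \succeq\ q\,\genfrac{[}{]}{0pt}{}{2L-2}{2}_{q}\,(-q^3;q)_{2L-4}. $$
   Context: The $q$-Pochhammer symbol is $(a;q)_N=\prod_{j=0}^{N-1}(1-aq^j)$ for integers $N\ge 0$, with $(a;q)_0=1$; in particular $(q;q^2)_N=\prod_{j=0}^{N-1}(1-q^{2j+1})$ and $(-q^3;q)_N=\prod_{j=0}^{N-1}(1+q^{3+j})$. The Gaussian polynomial is $\genfrac{[}{]}{0pt}{}{m}{n}_{q}=\frac{(q;q)_m}{(q;q)_n(q;q)_{m-n}}$ for integers $m\ge n\ge 0$, and it equals $0$ otherwise; $\genfrac{[}{]}{0pt}{}{m}{n}_{q^2}$ denotes the same polynomial with $q$ replaced by $q^2$. Reciprocals are expanded as formal power series in $q$. For formal power series $A(q),B(q)$ in $q$, $A(q)\succeq B(q)$ means that every coefficient of $A(q)-B(q)$ is nonnegative. *)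

theory Defs
  imports "HOL-Computational_Algebra.Formal_Power_Series"
begin

definition qpoch :: "rat fps \<Rightarrow> rat fps \<Rightarrow> nat \<Rightarrow> rat fps" where
  "qpoch a q N = (\<Prod>j<N. 1 - a * q ^ j)"

text \<open>
  The division is that of formal power series. It is the mathematical quotient whenever \<open>q\<close>
  has zero constant coefficient, since the denominator then has constant coefficient 1.
\<close>
definition gauss_poly :: "rat fps \<Rightarrow> nat \<Rightarrow> nat \<Rightarrow> rat fps" where
  "gauss_poly q m n =
     (if n \<le> m then qpoch q q m / (qpoch q q n * qpoch q q (m - n)) else 0)"

definition fps_succeq :: "rat fps \<Rightarrow> rat fps \<Rightarrow> bool"  (infix "\<succeq>" 50) where
  "A \<succeq> B \<longleftrightarrow> (\<forall>n. fps_nth (A - B) n \<ge> 0)"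

end

theory Submission
  imports Defs
begin

text \<open>
  Put \<open>n = L - 1\<close>, \<open>S k = 1 + q\<^sup>2 + \<dots> + q\<^bsup>2k-2\<^esup>\<close>, \<open>T = 1 + q + \<dots> + q\<^bsup>2n-2\<^esup>\<close> and
  \<open>P = (-q\<^sup>3;q)\<^bsub>2n-2\<^esub>\<close>. A finite form of Euler's theorem gives
  \<open>1 / (q;q\<^sup>2)\<^bsub>n\<^esub> = (-q;q)\<^bsub>2n\<^esub> D = (1+q) (1+q\<^sup>2) P D\<close> with
  \<open>D = 1 / (q\<^bsup>2n+2\<^esup>;q\<^sup>2)\<^bsub>n\<^esub> \<succeq> 1\<close>. The factor \<open>1+q\<^sup>2\<close> clears the denominator of the Gaussian
  polynomial, so the left-hand side is \<open>S n A P D\<close> with \<open>A = (1+q) (1 + q\<^sup>2 + q\<^sup>3 S (n-1))\<close>,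
  while the right-hand side is \<open>q S n T P\<close>. As \<open>A - q T = 1 + q\<^sup>3 + q\<^bsup>2n\<^esup>\<close>, the difference is
  \<open>S n P (A (D - 1) + 1 + q\<^sup>3 + q\<^bsup>2n\<^esup>)\<close>, a combination of series with nonnegative coefficients.
\<close>

section \<open>Closure properties of series with nonnegative coefficients\<close>

lemma succeq_zero_iff: "A \<succeq> 0 \<longleftrightarrow> (\<forall>n. fps_nth A n \<ge> 0)"
  by (simp add: fps_succeq_def)

lemma succeq_zero_one: "1 \<succeq> 0"
  by (simp add: succeq_zero_iff)

lemma succeq_zero_X: "fps_X \<succeq> 0"
  by (simp add: succeq_zero_iff fps_X_nth)

lemma succeq_zero_add: "A \<succeq> 0 \<Longrightarrow> B \<succeq> 0 \<Longrightarrow> A + B \<succeq> 0"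
  by (simp add: succeq_zero_iff)

lemma succeq_zero_mult: "A \<succeq> 0 \<Longrightarrow> B \<succeq> 0 \<Longrightarrow> A * B \<succeq> 0"
  by (simp add: succeq_zero_iff fps_mult_nth sum_nonneg)

lemma succeq_zero_power: "A \<succeq> 0 \<Longrightarrow> A ^ n \<succeq> 0"
  by (induction n) (simp_all add: succeq_zero_one succeq_zero_mult)

lemma succeq_zero_sum: "(\<And>i. i \<in> I \<Longrightarrow> f i \<succeq> 0) \<Longrightarrow> sum f I \<succeq> 0"
  by (simp add: succeq_zero_iff fps_sum_nth sum_nonneg)

lemma succeq_zero_prod: "(\<And>i. i \<in> I \<Longrightarrow> f i \<succeq> 0) \<Longrightarrow> prod f I \<succeq> 0"
  by (induction I rule: infinite_finite_induct) (simp_all add: succeq_zero_one succeq_zero_mult)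

lemmas succeq_zero_intros =
  succeq_zero_one succeq_zero_X succeq_zero_add succeq_zero_mult succeq_zero_power
  succeq_zero_sum succeq_zero_prod

text \<open>The inverse \<open>G\<close> satisfies \<open>G = 1 + A * G\<close>. As \<open>A\<close>
  has no constant term, each coefficient of \<open>G\<close> depends only on earlier ones, so strong
  induction applies.\<close>

lemma succeq_zero_inverse_one_minus:
  assumes "A \<succeq> 0" "fps_nth A 0 = 0"
  shows "inverse (1 - A) \<succeq> 0"
  unfolding succeq_zero_iff
proof
  fix n
  let ?G = "inverse (1 - A)"
  have "?G * (1 - A) = 1"
    by (rule inverse_mult_eq_1) (simp add: assms)
  then have G: "?G = 1 + A * ?G"
    by (simp add: algebra_simps)
  show "fps_nth ?G n \<ge> 0"
  proof (induction n rule: less_induct)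
    case (less n)
    have "fps_nth ?G n = fps_nth 1 n + (\<Sum>i=0..n. fps_nth A i * fps_nth ?G (n - i))"
      by (subst G) (simp add: fps_mult_nth)
    moreover have "fps_nth A i * fps_nth ?G (n - i) \<ge> 0" if "i \<in> {0..n}" for i
    proof (cases "i = 0")
      case False
      with that have "n - i < n" by simp
      with less assms(1) show ?thesis by (simp add: succeq_zero_iff)
    qed (simp add: assms)
    ultimately show ?case
      using sum_nonneg[of "{0..n}" "\<lambda>i. fps_nth A i * fps_nth ?G (n - i)"] by simp
  qed
qed

section \<open>Products and reciprocals of q-Pochhammer symbols\<close>

lemma fps_nth_0_qpoch: "fps_nth a 0 = 0 \<Longrightarrow> fps_nth (qpoch a q N) 0 = 1"
  by (induction N) (simp_all add: qpoch_def)

lemma qpoch_Suc: "qpoch a q (Suc N) = qpoch a q N * (1 - a * q ^ N)"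
  by (simp add: qpoch_def)

lemma qpoch_Suc_left: "qpoch a q (Suc N) = (1 - a) * qpoch (a * q) q N"
  by (simp add: qpoch_def prod.lessThan_Suc_shift mult.assoc del: prod.lessThan_Suc)

lemma qpoch_add: "qpoch a q (M + N) = qpoch a q M * qpoch (a * q ^ M) q N"
  by (induction N) (simp_all add: qpoch_Suc power_add mult.assoc, simp add: qpoch_def)

text \<open>A product of nonnegative reciprocals is nonnegative, and subtracting 1 only cancels its
  constant coefficient, which is exactly 1.\<close>

lemma inverse_qpoch_succeq_one:
  assumes "a \<succeq> 0" "q \<succeq> 0" "fps_nth a 0 = 0"
  shows "inverse (qpoch a q N) - 1 \<succeq> 0"
proof -
  have "inverse (qpoch a q N) \<succeq> 0"
  proof (induction N)
    case 0
    show ?case by (simp add: qpoch_def succeq_zero_one)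
  next
    case (Suc N)
    have "inverse (1 - a * q ^ N) \<succeq> 0"
      using assms by (intro succeq_zero_inverse_one_minus succeq_zero_intros) simp_all
    with Suc show ?case
      by (simp add: qpoch_Suc fps_inverse_mult succeq_zero_mult)
  qed
  then show ?thesis
    using assms(3) by (auto simp: succeq_zero_iff fps_nth_0_qpoch)
qed

text \<open>Multiplied by \<open>(q^2;q^2)_n\<close>, the left side becomes
  \<open>(q;q)_{2n} (-q;q)_{2n} = (q^2;q^2)_{2n}\<close>. The factor is then cancelled, being
  nonzero by its constant coefficient.\<close>

lemma qpoch_euler_finite:
  assumes "fps_nth q 0 = 0"
  shows "qpoch q (q ^ 2) n * qpoch (- q) q (2 * n) = qpoch (q ^ (2 * n + 2)) (q ^ 2) n"
proof -
  let ?E = "qpoch (q ^ 2) (q ^ 2)"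
  have "qpoch q (q ^ 2) n * qpoch (- q) q (2 * n) * ?E n = ?E (2 * n)"
  proof (induction n)
    case 0
    show ?case by (simp add: qpoch_def)
  next
    case (Suc n)
    \<comment> \<open>With \<open>x\<close> for \<open>q ^ n\<close>, the inductive step is a
      polynomial identity in \<open>q\<close> and \<open>x\<close>.\<close>
    define x where "x = q ^ n"
    have pow: "q ^ (2 * n) = x ^ 2" "q ^ (n * 2) = x ^ 2" "(q ^ 2) ^ n = x ^ 2" "(q ^ 2) ^ (2 * n) = x ^ 4" "(q ^ 2) ^ (n * 2) = x ^ 4"
      by (simp_all add: x_def flip: power_mult) (simp_all add: mult.commute)
    have "qpoch q (q ^ 2) (Suc n) * qpoch (- q) q (2 * Suc n) * ?E (Suc n)
        = (qpoch q (q ^ 2) n * qpoch (- q) q (2 * n) * ?E n)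
          * ((1 - q * x ^ 2) * (1 + q * x ^ 2) * (1 + q * (q * x ^ 2)) * (1 - q ^ 2 * x ^ 2))"
      by (simp add: qpoch_Suc pow mult_ac)
    also have "(1 - q * x ^ 2) * (1 + q * x ^ 2) * (1 + q * (q * x ^ 2)) * (1 - q ^ 2 * x ^ 2)
        = (1 - q ^ 2 * x ^ 4) * (1 - q ^ 2 * (q ^ 2 * x ^ 4))"
      by algebra
    also have "(qpoch q (q ^ 2) n * qpoch (- q) q (2 * n) * ?E n) * \<dots> = ?E (2 * Suc n)"
      unfolding Suc.IH by (simp add: qpoch_Suc pow mult_ac)
    finally show ?case .
  qed
  also have "?E (2 * n) = qpoch (q ^ (2 * n + 2)) (q ^ 2) n * ?E n"
  proof -
    have "q ^ 2 * (q ^ 2) ^ n = q ^ (2 * n + 2)"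
      by (simp add: power_add power_mult power2_eq_square)
    with qpoch_add[of "q ^ 2" "q ^ 2" n n] show ?thesis
      by (simp only: mult_2[symmetric] mult.commute)
  qed
  finally show ?thesis
    using fps_nth_0_qpoch[of "q ^ 2" "q ^ 2" n] assms by auto
qed

section \<open>Geometric sums and the Gaussian polynomial with lower index 2\<close>

lemma one_minus_power_eq: "1 - x ^ k = (1 - x) * (\<Sum>i<k. x ^ i)" for x :: "'a :: comm_ring_1"
  using power_diff_1_eq[of x k] by (simp add: algebra_simps)

text \<open>This is \<open>(1-x^m)(1-x^(m-1)) / ((1-x)(1-x^2))\<close> with \<open>(1-x)^2\<close>
  cancelled and \<open>1+x\<close> moved across, which leaves no quotient on the right.\<close>

lemma gauss_poly_2:
  assumes "fps_nth x 0 = 0"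
  shows "gauss_poly x m 2 * (1 + x) = (\<Sum>i<m. x ^ i) * (\<Sum>i<m - 1. x ^ i)"
proof (cases "m \<ge> 2")
  case True
  then obtain k where m: "m = Suc (Suc k)"
    by (metis Suc_le_D numeral_2_eq_2 Suc_le_mono)
  have unit: "fps_nth (qpoch x x N) 0 = 1" for N
    using assms by (rule fps_nth_0_qpoch)
  have "gauss_poly x m 2 * (qpoch x x 2 * qpoch x x k) = qpoch x x m"
    using unit by (simp add: gauss_poly_def m fps_divide_unit mult.assoc inverse_mult_eq_1)
  also have "qpoch x x m = qpoch x x k * ((1 - x ^ Suc k) * (1 - x ^ m))"
    by (simp add: m qpoch_Suc mult_ac)
  also have "\<dots> = (1 - x) ^ 2 * qpoch x x k * ((\<Sum>i<m. x ^ i) * (\<Sum>i<m - 1. x ^ i))"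
    unfolding one_minus_power_eq[of x "Suc k"] one_minus_power_eq[of x m]
    by (simp add: m power2_eq_square mult_ac del: sum.lessThan_Suc)
  also have "qpoch x x 2 = (1 - x) ^ 2 * (1 + x)"
    by (simp add: qpoch_def numeral_2_eq_2) (simp add: algebra_simps)
  finally have "((1 - x) ^ 2 * qpoch x x k) * (gauss_poly x m 2 * (1 + x))
      = ((1 - x) ^ 2 * qpoch x x k) * ((\<Sum>i<m. x ^ i) * (\<Sum>i<m - 1. x ^ i))"
    by (simp only: mult_ac)
  moreover have "fps_nth (1 - x) 0 \<noteq> 0" "fps_nth (qpoch x x k) 0 \<noteq> 0"
    using assms unit by simp_all
  then have "(1 - x) ^ 2 * qpoch x x k \<noteq> 0"
    by auto
  ultimately show ?thesis
    by simp
next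
  case False
  \<comment> \<open>In both cases \<open>m - 1 = 0\<close>, so the second sum is empty.\<close>
  then consider "m = 0" | "m = 1" by linarith
  then show ?thesis by cases (simp_all add: gauss_poly_def)
qed

lemma sum_powers_double:
  "(\<Sum>i<2 * k. x ^ i) = (1 + x) * (\<Sum>i<k. (x ^ 2) ^ i)" for x :: "'a :: comm_ring_1"
  by (induction k) (simp_all add: algebra_simps flip: power_mult)

theorem theorem1p2:
  fixes q :: "rat fps" and L :: nat
  defines "q \<equiv> fps_X"
  assumes "L \<ge> 2"
  shows "1 / qpoch q (q ^ 2) (L - 1) *
           ((1 - q ^ (2 * L - 2)) / (1 - q ^ 2) + q ^ 3 * gauss_poly (q ^ 2) (L - 1) 2)
         \<succeq> q * gauss_poly q (2 * L - 2) 2 * qpoch (- (q ^ 3)) q (2 * L - 4)"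
proof -
  \<comment> \<open>With \<open>L = m + 2\<close> and \<open>n = m + 1\<close>, the truncated
    differences \<open>2 * L - 2\<close> and \<open>2 * L - 4\<close> become \<open>2 * n\<close>
    and \<open>2 * m\<close>.\<close>
  obtain m where L: "L = Suc (Suc m)"
    using assms(2) by (metis Suc_le_D numeral_2_eq_2 Suc_le_mono)
  define n where "n = Suc m"
  have q0: "fps_nth q 0 = 0" and q_nonneg: "q \<succeq> 0"
    by (simp_all add: q_def succeq_zero_X)
  have nz: "1 + q \<noteq> 0" "1 - q ^ 2 \<noteq> 0" "1 + q ^ 2 \<noteq> 0"
  proof -
    have "fps_nth (1 + q) 0 \<noteq> 0" "fps_nth (1 - q ^ 2) 0 \<noteq> 0" "fps_nth (1 + q ^ 2) 0 \<noteq> 0"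
      using q0 by (simp_all add: fps_power_zeroth)
    then show "1 + q \<noteq> 0" "1 - q ^ 2 \<noteq> 0" "1 + q ^ 2 \<noteq> 0"
      by (metis fps_zero_nth)+
  qed
  define S where "S = (\<lambda>k. \<Sum>i<k. (q ^ 2) ^ i)"
  define T where "T = (\<Sum>i<Suc (2 * m). q ^ i)"
  define P where "P = qpoch (- (q ^ 3)) q (2 * m)"
  define D where "D = inverse (qpoch (q ^ (2 * n + 2)) (q ^ 2) n)"
  define G where "G = gauss_poly (q ^ 2) n 2"
  define A where "A = (1 + q) * (1 + q ^ 2 + q ^ 3 * S m)"

  have quot: "(1 - q ^ (2 * n)) / (1 - q ^ 2) = S n"
    using nz(2) by (simp add: S_def power_mult one_minus_power_eq[of "q ^ 2" n])
  have gauss: "gauss_poly q (2 * n) 2 = S n * T"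
  proof -
    have "gauss_poly q (2 * n) 2 * (1 + q) = ((1 + q) * S n) * T"
      using gauss_poly_2[OF q0, of "2 * n"] unfolding sum_powers_double S_def T_def
      by (simp add: n_def del: sum.lessThan_Suc)
    then have "gauss_poly q (2 * n) 2 * (1 + q) = (S n * T) * (1 + q)"
      by (simp only: mult_ac)
    with nz(1) show ?thesis by simp
  qed
  have gauss_sq: "G * (1 + q ^ 2) = S n * S m"
    using gauss_poly_2[of "q ^ 2" n] q0 by (simp add: G_def S_def n_def del: sum.lessThan_Suc)

  have split_poch: "qpoch (- q) q (2 * n) = (1 + q) * (1 + q ^ 2) * P"
    by (simp add: n_def qpoch_Suc_left P_def power2_eq_square power3_eq_cube mult.assoc)
  have recip: "1 / qpoch q (q ^ 2) n = (1 + q) * (1 + q ^ 2) * P * D"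
  proof -
    let ?a = "qpoch q (q ^ 2) n" and ?b = "qpoch (- q) q (2 * n)"
    have a: "fps_nth ?a 0 = 1" and b: "fps_nth ?b 0 = 1"
      using q0 by (simp_all add: fps_nth_0_qpoch)
    have "?b * D = ?b * (inverse ?a * inverse ?b)"
      unfolding D_def qpoch_euler_finite[OF q0, symmetric] fps_inverse_mult ..
    also have "\<dots> = inverse ?a * (inverse ?b * ?b)"
      by (simp only: mult_ac)
    also have "\<dots> = 1 / ?a"
      using a b by (simp add: inverse_mult_eq_1 fps_divide_unit)
    finally show ?thesis by (simp add: split_poch)
  qed

  have A: "A = q * T + 1 + q ^ 3 + q ^ (2 * n)"
  proof -
    define U where "U = (\<Sum>i<2 * m. q ^ i)"
    have "1 + q * U = U + q ^ (2 * m)"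
      using one_minus_power_eq[of q "2 * m"] by (simp add: U_def algebra_simps)
    \<comment> \<open>Eliminating \<open>q ^ (2 * m)\<close> turns both sides of the claim into
      polynomials in \<open>q\<close> and \<open>U\<close>, where
      \<open>U = (1 + q) * S m\<close>.\<close>
    then have x: "q ^ (2 * m) = 1 + q * U - U"
      by (simp add: algebra_simps)
    have "A = (1 + q) * (1 + q ^ 2) + q ^ 3 * U"
      unfolding A_def U_def sum_powers_double S_def by (simp add: algebra_simps)
    moreover have "T = U + q ^ (2 * m)"
      by (simp add: T_def U_def)
    moreover have "q ^ (2 * n) = q ^ 2 * q ^ (2 * m)"
      by (simp add: n_def power2_eq_square)
    ultimately show ?thesis
      unfolding x by (simp add: algebra_simps power2_eq_square power3_eq_cube)
  qed

  have "1 / qpoch q (q ^ 2) n * (S n + q ^ 3 * G)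
      = (1 + q) * P * D * (S n * (1 + q ^ 2) + q ^ 3 * (G * (1 + q ^ 2)))"
    unfolding recip by (simp only: algebra_simps)
  also have "\<dots> = S n * P * A * D"
    unfolding gauss_sq A_def by (simp only: algebra_simps)
  \<comment> \<open>Here \<open>A * D - q * T = A * (D - 1) + (A - q * T)\<close>.\<close>
  finally have "1 / qpoch q (q ^ 2) n * (S n + q ^ 3 * G) - q * (S n * T) * P
      = S n * P * (A * (D - 1) + (1 + q ^ 3 + q ^ (2 * n)))"
    unfolding A by (simp only: algebra_simps) simp
  moreover have "\<dots> \<succeq> 0"
  proof -
    have "S k \<succeq> 0" for k
      unfolding S_def by (intro succeq_zero_intros q_nonneg)
    moreover have "P \<succeq> 0"
      \<comment> \<open>Simplification first merges the two minus signs, so each factor is a sum of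
        nonnegative series.\<close>
      unfolding P_def qpoch_def by (simp, intro succeq_zero_intros q_nonneg)
    moreover have "D - 1 \<succeq> 0"
      unfolding D_def using q0
      by (intro inverse_qpoch_succeq_one succeq_zero_intros q_nonneg) simp
    ultimately show ?thesis
      unfolding A_def by (intro succeq_zero_intros q_nonneg)
  qed
  ultimately have "1 / qpoch q (q ^ 2) n * ((1 - q ^ (2 * n)) / (1 - q ^ 2) + q ^ 3 * G)
      \<succeq> q * gauss_poly q (2 * n) 2 * P"
    by (simp add: fps_succeq_def quot gauss)
  then show ?thesis
    by (simp add: L n_def G_def P_def)
qed

end
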